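(* If a profinite algebra $A$ is a left D-ring, then $A$ is finite dimensional.
   Context: A profinite algebra is an algebra over a field $\Bbbk$ which is an inverse limit of finite dimensional $\Bbbk$-algebras (equivalently, $A\cong C^*$ for some $\Bbbk$-coalgebra $C$). A ring $R$ is a left D-ring if every left ideal of $R$ is a left annihilator, i.e. of the form $\{r\in R\mid rx=0\ \forall x\in X\}$ for some subset $X\subseteq R$; equivalently, every cyclic left $R$-module embeds in a direct product of copies of $R$. *)

theory Defs
  imports "HOL-Algebra.Algebra"
begin

definition k_algebra :: "'k ring \<Rightarrow> ('k, 'a) module \<Rightarrow> bool" where
  "k_algebra K A \<longleftrightarrow> field K \<and> module K A \<and> ring A \<and>
     (\<forall>c \<in> carrier K. \<forall>x \<in> carrier A. \<forall>y \<in> carrier A.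
        (c \<odot>\<^bsub>A\<^esub> x) \<otimes>\<^bsub>A\<^esub> y = c \<odot>\<^bsub>A\<^esub> (x \<otimes>\<^bsub>A\<^esub> y) \<and>
        x \<otimes>\<^bsub>A\<^esub> (c \<odot>\<^bsub>A\<^esub> y) = c \<odot>\<^bsub>A\<^esub> (x \<otimes>\<^bsub>A\<^esub> y))"

definition finite_dim :: "'k ring \<Rightarrow> ('k, 'a) module \<Rightarrow> bool" where
  "finite_dim K A \<longleftrightarrow> (\<exists>S. finite S \<and> S \<subseteq> carrier A \<and>
     (\<forall>x \<in> carrier A. \<exists>c. c \<in> S \<rightarrow> carrier K \<and>
        x = finsum A (\<lambda>s. c s \<odot>\<^bsub>A\<^esub> s) S))"

definition alg_hom :: "'k ring \<Rightarrow> ('k, 'a) module \<Rightarrow> ('k, 'b) module \<Rightarrow> ('a \<Rightarrow> 'b) \<Rightarrow> bool" where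
  "alg_hom K A B h \<longleftrightarrow> h \<in> ring_hom A B \<and>
     (\<forall>c \<in> carrier K. \<forall>x \<in> carrier A. h (c \<odot>\<^bsub>A\<^esub> x) = c \<odot>\<^bsub>B\<^esub> h x)"

definition alg_iso :: "'k ring \<Rightarrow> ('k, 'a) module \<Rightarrow> ('k, 'b) module \<Rightarrow> ('a \<Rightarrow> 'b) \<Rightarrow> bool" where
  "alg_iso K A B h \<longleftrightarrow> alg_hom K A B h \<and> bij_betw h (carrier A) (carrier B)"

definition fd_inverse_system ::
  "'k ring \<Rightarrow> 'j set \<Rightarrow> ('j \<Rightarrow> 'j \<Rightarrow> bool) \<Rightarrow> ('j \<Rightarrow> ('k, 'b) module) \<Rightarrow> ('j \<Rightarrow> 'j \<Rightarrow> 'b \<Rightarrow> 'b) \<Rightarrow> bool" where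
  "fd_inverse_system K J lej B f \<longleftrightarrow>
     J \<noteq> {} \<and>
     (\<forall>i \<in> J. lej i i) \<and>
     (\<forall>i \<in> J. \<forall>j \<in> J. \<forall>l \<in> J. lej i j \<and> lej j l \<longrightarrow> lej i l) \<and>
     (\<forall>i \<in> J. \<forall>j \<in> J. \<exists>l \<in> J. lej i l \<and> lej j l) \<and>
     (\<forall>j \<in> J. k_algebra K (B j) \<and> finite_dim K (B j)) \<and>
     (\<forall>i \<in> J. \<forall>j \<in> J. lej i j \<longrightarrow> alg_hom K (B j) (B i) (f i j)) \<and>
     (\<forall>i \<in> J. \<forall>x \<in> carrier (B i). f i i x = x) \<and>
     (\<forall>i \<in> J. \<forall>j \<in> J. \<forall>l \<in> J. lej i j \<and> lej j l \<longrightarrow>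
        (\<forall>x \<in> carrier (B l). f i j (f j l x) = f i l x))"

definition inv_limit ::
  "'j set \<Rightarrow> ('j \<Rightarrow> 'j \<Rightarrow> bool) \<Rightarrow> ('j \<Rightarrow> ('k, 'b) module) \<Rightarrow> ('j \<Rightarrow> 'j \<Rightarrow> 'b \<Rightarrow> 'b) \<Rightarrow> ('k, 'j \<Rightarrow> 'b) module" where
  "inv_limit J lej B f =
     \<lparr> carrier = {x \<in> (\<Pi>\<^sub>E j\<in>J. carrier (B j)).
                    \<forall>i \<in> J. \<forall>j \<in> J. lej i j \<longrightarrow> f i j (x j) = x i},
       monoid.mult = (\<lambda>x y. \<lambda>j\<in>J. x j \<otimes>\<^bsub>B j\<^esub> y j),
       monoid.one = (\<lambda>j\<in>J. \<one>\<^bsub>B j\<^esub>),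
       ring.zero = (\<lambda>j\<in>J. \<zero>\<^bsub>B j\<^esub>),
       ring.add = (\<lambda>x y. \<lambda>j\<in>J. x j \<oplus>\<^bsub>B j\<^esub> y j),
       module.smult = (\<lambda>c x. \<lambda>j\<in>J. c \<odot>\<^bsub>B j\<^esub> x j) \<rparr>"

definition profinite_via ::
  "'k ring \<Rightarrow> ('k, 'a) module \<Rightarrow> 'j set \<Rightarrow> ('j \<Rightarrow> 'j \<Rightarrow> bool) \<Rightarrow> ('j \<Rightarrow> ('k, 'b) module) \<Rightarrow> ('j \<Rightarrow> 'j \<Rightarrow> 'b \<Rightarrow> 'b) \<Rightarrow> bool" where
  "profinite_via K A J lej B f \<longleftrightarrow>
     k_algebra K A \<and> fd_inverse_system K J lej B f \<and>
     (\<exists>h. alg_iso K A (inv_limit J lej B f) h)"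

definition left_ideal :: "('a, 'm) ring_scheme \<Rightarrow> 'a set \<Rightarrow> bool" where
  "left_ideal R I \<longleftrightarrow> additive_subgroup I R \<and>
     (\<forall>r \<in> carrier R. \<forall>x \<in> I. r \<otimes>\<^bsub>R\<^esub> x \<in> I)"

definition left_ann :: "('a, 'm) ring_scheme \<Rightarrow> 'a set \<Rightarrow> 'a set" where
  "left_ann R Y = {r \<in> carrier R. \<forall>x \<in> Y. r \<otimes>\<^bsub>R\<^esub> x = ring.zero R}"

definition left_D_ring :: "('a, 'm) ring_scheme \<Rightarrow> bool" where
  "left_D_ring R \<longleftrightarrow> (\<forall>I. left_ideal R I \<longrightarrow> (\<exists>Y \<subseteq> carrier R. I = left_ann R Y))"

end

theory Submission
  imports Defs
begin

text \<open>
  Let \<open>U\<^sub>j\<close> be the kernel of the projection \<open>A \<rightarrow> B\<^sub>j\<close>. Annihilators are closed, so in a left D-ring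
  every left ideal is closed. A Baire category argument, with linear compactness of inverse limits
  of finite dimensional spaces in place of completeness, then yields the ascending chain condition
  on left ideals. Applied to the directed family of right annihilators of the \<open>U\<^sub>j\<close>, it gives
  one that contains all others; as \<open>U\<^sub>j\<close> is the left annihilator of its right annihilator, the
  corresponding \<open>U\<^sub>j\<close> is contained in all the others. Their intersection is 0, so
  \<open>A\<close> embeds in \<open>B\<^sub>j\<close>.
\<close>

section \<open>Spans of finite sets and a rank function on submodules\<close>

text \<open>The body copies the spanning condition of \<open>finite_dim\<close>, so that
  \<open>finite_dim K M\<close> unfolds to \<open>carrier M \<subseteq> lincomb K M S\<close> for
  some finite \<open>S\<close> in the carrier.\<close>

definition lincomb :: "('k, 'm) ring_scheme \<Rightarrow> ('k, 'b, 'n) module_scheme \<Rightarrow> 'b set \<Rightarrow> 'b set" where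
  "lincomb K M S = {x. \<exists>c. c \<in> S \<rightarrow> carrier K \<and> x = finsum M (\<lambda>s. c s \<odot>\<^bsub>M\<^esub> s) S}"

lemma (in module) submodule_zero:
  assumes "submodule W R M"
  shows "\<zero>\<^bsub>M\<^esub> \<in> W"
proof -
  note E = submoduleE[OF assms]
  obtain x where x: "x \<in> W" using E(2) by blast
  then have "x \<oplus>\<^bsub>M\<^esub> \<ominus>\<^bsub>M\<^esub> x \<in> W" using E(3,5) by blast
  then show ?thesis using x E(1) by (simp add: M.r_neg subset_iff)
qed

lemma (in module) submodule_diff:
  "\<lbrakk>submodule W R M; x \<in> W; y \<in> W\<rbrakk> \<Longrightarrow> x \<ominus>\<^bsub>M\<^esub> y \<in> W"
  unfolding a_minus_def by (intro submoduleE(3,5))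

text \<open>Splits off the summand at \<open>s\<close>; conversely, a coefficient function on
  \<open>S\<close> can be overwritten at \<open>s\<close> without changing the sum over
  \<open>S\<close>, because \<open>s\<close> is new. Inductions on the spanning set rest on this
  form.\<close>

lemma (in module) lincomb_insert:
  assumes "finite S" "s \<notin> S" "insert s S \<subseteq> carrier M"
  shows "lincomb R M (insert s S) = {a \<odot>\<^bsub>M\<^esub> s \<oplus>\<^bsub>M\<^esub> t | a t. a \<in> carrier R \<and> t \<in> lincomb R M S}"
proof (intro equalityI subsetI)
  fix x assume "x \<in> lincomb R M (insert s S)"
  then obtain c where c: "c \<in> insert s S \<rightarrow> carrier R"
    and x: "x = finsum M (\<lambda>s. c s \<odot>\<^bsub>M\<^esub> s) (insert s S)"
    unfolding lincomb_def by blast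
  have "x = c s \<odot>\<^bsub>M\<^esub> s \<oplus>\<^bsub>M\<^esub> finsum M (\<lambda>s. c s \<odot>\<^bsub>M\<^esub> s) S"
    unfolding x by (rule M.finsum_insert) (use assms c in \<open>auto simp: Pi_iff subset_iff\<close>)
  then show "x \<in> {a \<odot>\<^bsub>M\<^esub> s \<oplus>\<^bsub>M\<^esub> t | a t. a \<in> carrier R \<and> t \<in> lincomb R M S}"
    using c unfolding lincomb_def by blast
next
  fix x assume "x \<in> {a \<odot>\<^bsub>M\<^esub> s \<oplus>\<^bsub>M\<^esub> t | a t. a \<in> carrier R \<and> t \<in> lincomb R M S}"
  then obtain a c where a: "a \<in> carrier R" and c: "c \<in> S \<rightarrow> carrier R"
    and x: "x = a \<odot>\<^bsub>M\<^esub> s \<oplus>\<^bsub>M\<^esub> finsum M (\<lambda>s. c s \<odot>\<^bsub>M\<^esub> s) S"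
    unfolding lincomb_def by blast
  define d where "d = c(s := a)"
  have d: "d \<in> insert s S \<rightarrow> carrier R" "d s = a"
    using a c assms(2) by (auto simp: d_def Pi_iff)
  have "finsum M (\<lambda>s. d s \<odot>\<^bsub>M\<^esub> s) (insert s S) = d s \<odot>\<^bsub>M\<^esub> s \<oplus>\<^bsub>M\<^esub> finsum M (\<lambda>s. d s \<odot>\<^bsub>M\<^esub> s) S"
    by (rule M.finsum_insert) (use assms d in \<open>auto simp: Pi_iff subset_iff\<close>)
  also have "finsum M (\<lambda>s. d s \<odot>\<^bsub>M\<^esub> s) S = finsum M (\<lambda>s. c s \<odot>\<^bsub>M\<^esub> s) S"
    by (rule M.finsum_cong') (use assms c in \<open>auto simp: d_def Pi_iff subset_iff\<close>)
  finally show "x \<in> lincomb R M (insert s S)"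
    using d x unfolding lincomb_def by auto
qed

lemma (in module) lincomb_submodule:
  assumes "finite S" "S \<subseteq> carrier M"
  shows "submodule (lincomb R M S) R M"
  using assms
proof (induction S)
  case empty
  show ?case
    by (rule submoduleI) (auto simp: lincomb_def)
next
  case (insert s S)
  then have sub: "submodule (lincomb R M S) R M" and s: "s \<in> carrier M" by auto
  note E = submoduleE[OF sub]
  note eq = lincomb_insert[OF insert.hyps insert.prems]
  have carr: "t \<in> carrier M" if "t \<in> lincomb R M S" for t
    using E(1) that by blast
  have zero: "\<zero>\<^bsub>M\<^esub> \<in> lincomb R M S"
    by (rule submodule_zero[OF sub])
  show ?case
    unfolding eq
  proof (rule submoduleI, goal_cases)
    case 1
    show ?case using carr s by auto
  next
    case 2
    have "\<zero>\<^bsub>M\<^esub> = \<zero> \<odot>\<^bsub>M\<^esub> s \<oplus>\<^bsub>M\<^esub> \<zero>\<^bsub>M\<^esub>" using s by simp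
    then show ?case using zero by blast
  next
    case (3 x)
    then obtain a t where a: "a \<in> carrier R" "t \<in> lincomb R M S" "x = a \<odot>\<^bsub>M\<^esub> s \<oplus>\<^bsub>M\<^esub> t" by blast
    then have "\<ominus>\<^bsub>M\<^esub> x = (\<ominus> a) \<odot>\<^bsub>M\<^esub> s \<oplus>\<^bsub>M\<^esub> \<ominus>\<^bsub>M\<^esub> t"
      using s carr by (simp add: smult_l_minus M.minus_add)
    then show ?case using a E(3) by blast
  next
    case (4 x y)
    then obtain a t b u where a: "a \<in> carrier R" "t \<in> lincomb R M S" "x = a \<odot>\<^bsub>M\<^esub> s \<oplus>\<^bsub>M\<^esub> t"
      "b \<in> carrier R" "u \<in> lincomb R M S" "y = b \<odot>\<^bsub>M\<^esub> s \<oplus>\<^bsub>M\<^esub> u" by blast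
    then have "x \<oplus>\<^bsub>M\<^esub> y = (a \<oplus> b) \<odot>\<^bsub>M\<^esub> s \<oplus>\<^bsub>M\<^esub> (t \<oplus>\<^bsub>M\<^esub> u)"
      using s carr by (simp add: smult_l_distr M.a_ac)
    then show ?case using a E(5) by blast
  next
    case (5 c x)
    then obtain a t where a: "a \<in> carrier R" "t \<in> lincomb R M S" "x = a \<odot>\<^bsub>M\<^esub> s \<oplus>\<^bsub>M\<^esub> t" by blast
    then have "c \<odot>\<^bsub>M\<^esub> x = (c \<otimes> a) \<odot>\<^bsub>M\<^esub> s \<oplus>\<^bsub>M\<^esub> c \<odot>\<^bsub>M\<^esub> t"
      using s carr 5 by (simp add: smult_r_distr smult_assoc1)
    then show ?case using a E(4) 5 by blast
  qed
qed

lemma (in module) submodule_Int: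
  assumes "submodule V R M" "submodule W R M"
  shows "submodule (V \<inter> W) R M"
proof (rule submoduleI)
  show "V \<inter> W \<subseteq> carrier M" using submoduleE(1)[OF assms(1)] by blast
  show "\<zero>\<^bsub>M\<^esub> \<in> V \<inter> W" using assms submodule_zero by blast
qed (use submoduleE(3-5)[OF assms(1)] submoduleE(3-5)[OF assms(2)] in auto)

lemma (in module) lincomb_superset:
  assumes "finite S" "S \<subseteq> carrier M"
  shows "S \<subseteq> lincomb R M S"
  using assms
proof (induction S)
  case (insert s S)
  have s: "s \<in> carrier M" and sub: "submodule (lincomb R M S) R M"
    using insert lincomb_submodule by auto
  have carr: "lincomb R M S \<subseteq> carrier M" using submoduleE(1)[OF sub] .
  have "s = \<one> \<odot>\<^bsub>M\<^esub> s \<oplus>\<^bsub>M\<^esub> \<zero>\<^bsub>M\<^esub>" using s by simp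
  moreover have "t = \<zero> \<odot>\<^bsub>M\<^esub> s \<oplus>\<^bsub>M\<^esub> t" if "t \<in> lincomb R M S" for t
    using s carr that by auto
  ultimately show ?case
    unfolding lincomb_insert[OF insert.hyps insert.prems]
    using insert submodule_zero[OF sub] by blast
qed simp

lemma (in module) lincomb_insert_mono:
  assumes "finite S" "insert s S \<subseteq> carrier M"
  shows "lincomb R M S \<subseteq> lincomb R M (insert s S)"
proof (cases "s \<in> S")
  case True
  then show ?thesis by (simp add: insert_absorb)
next
  case False
  have s: "s \<in> carrier M" and carr: "lincomb R M S \<subseteq> carrier M"
    using assms submoduleE(1)[OF lincomb_submodule, of S] by auto
  have "t = \<zero> \<odot>\<^bsub>M\<^esub> s \<oplus>\<^bsub>M\<^esub> t" if "t \<in> lincomb R M S" for t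
    using s carr that by auto
  then show ?thesis
    unfolding lincomb_insert[OF assms(1) False assms(2)] by blast
qed

text \<open>The function \<open>r\<close> is the dimension, in the only form needed: a bounded, strictly monotone
  function on submodules gives both chain conditions at once.\<close>

lemma (in module) rank_exists:
  assumes "field R" "finite S" "S \<subseteq> carrier M"
  shows "\<exists>(r :: 'c set \<Rightarrow> nat) N. \<forall>V W. submodule V R M \<longrightarrow> submodule W R M \<longrightarrow> V \<subseteq> W \<longrightarrow>
    W \<subseteq> lincomb R M S \<longrightarrow> r V \<le> r W \<and> r W \<le> N \<and> (r V = r W \<longrightarrow> V = W)"
  using assms(2,3)
proof (induction S)
  case empty
  have "lincomb R M {} = {\<zero>\<^bsub>M\<^esub>}" by (auto simp: lincomb_def)
  then have "V = W" if "submodule V R M" "V \<subseteq> W" "W \<subseteq> lincomb R M {}" for V W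
    using that submodule_zero[of V] by auto
  then show ?case by (intro exI[of _ "\<lambda>_. 0"] exI[of _ 0]) auto
next
  case (insert s S)
  let ?L = "lincomb R M S"
  have s: "s \<in> carrier M" and L: "submodule ?L R M"
    using insert lincomb_submodule by auto
  note Lc = submoduleE(1)[OF L]
  have "S \<subseteq> carrier M" using insert.prems by simp
  from insert.IH[OF this] obtain r :: "'c set \<Rightarrow> nat" and N where
    r: "\<forall>V W. submodule V R M \<longrightarrow> submodule W R M \<longrightarrow> V \<subseteq> W \<longrightarrow>
      W \<subseteq> ?L \<longrightarrow> r V \<le> r W \<and> r W \<le> N \<and> (r V = r W \<longrightarrow> V = W)"
    by (elim exE) (rule that)
  \<comment> \<open>\<open>b W\<close> says that \<open>s\<close> lies in the sum of
    \<open>W\<close> and \<open>?L\<close>. Both summands of \<open>r'\<close> are monotone, so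
    equal values of \<open>r'\<close> force equality in each summand.\<close>
  define b where "b W \<longleftrightarrow> (\<exists>t\<in>?L. s \<oplus>\<^bsub>M\<^esub> t \<in> W)" for W
  define r' where "r' W = r (W \<inter> ?L) + (if b W then 1 else 0)" for W
  have "r' V \<le> r' W \<and> r' W \<le> N + 1 \<and> (r' V = r' W \<longrightarrow> V = W)"
    if VW: "submodule V R M" "submodule W R M" "V \<subseteq> W" and W: "W \<subseteq> lincomb R M (insert s S)" for V W
  proof -
    have rr: "r (V \<inter> ?L) \<le> r (W \<inter> ?L)" "r (W \<inter> ?L) \<le> N"
      "r (V \<inter> ?L) = r (W \<inter> ?L) \<Longrightarrow> V \<inter> ?L = W \<inter> ?L"
      using r[rule_format, OF submodule_Int[OF VW(1) L] submodule_Int[OF VW(2) L]] VW(3) by auto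
    have bb: "b V \<Longrightarrow> b W" using VW(3) by (auto simp: b_def)
    have "V = W" if eq: "r' V = r' W"
    proof
      show "W \<subseteq> V"
      proof
        fix w assume w: "w \<in> W"
        have eqs: "V \<inter> ?L = W \<inter> ?L" "b V \<longleftrightarrow> b W"
          using eq rr bb by (auto simp: r'_def split: if_splits)
        obtain a t where a: "a \<in> carrier R" and t: "t \<in> ?L" and wt: "w = a \<odot>\<^bsub>M\<^esub> s \<oplus>\<^bsub>M\<^esub> t"
          using w W unfolding lincomb_insert[OF insert.hyps insert.prems] by blast
        have tc: "t \<in> carrier M" using t Lc by blast
        show "w \<in> V"
        proof (cases "a = \<zero>")
          case True
          then have "w = t" using wt s tc by simp
          then show ?thesis using w t eqs by blast
        next
          case False
          \<comment> \<open>A nonzero coefficient scales to 1, which gives \<open>b W\<close>, hence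
            \<open>b V\<close> and some \<open>s + u\<close> in \<open>V\<close>. Subtracting
            \<open>a (s + u)\<close> from \<open>w\<close> cancels \<open>s\<close> and leaves an
            element of \<open>W \<inter> ?L = V \<inter> ?L\<close>.\<close>
          let ?c = "inv\<^bsub>R\<^esub> a"
          have c: "?c \<in> carrier R" "?c \<otimes> a = \<one>"
            using assms(1) a False by (auto simp: field.field_Units)
          have "?c \<odot>\<^bsub>M\<^esub> w = s \<oplus>\<^bsub>M\<^esub> ?c \<odot>\<^bsub>M\<^esub> t"
            using a c s tc by (simp add: wt smult_r_distr smult_assoc1[symmetric])
          then have "b W"
            unfolding b_def using submoduleE(4)[OF VW(2) c(1) w] submoduleE(4)[OF L c(1) t] by auto
          then obtain u where u: "u \<in> ?L" "s \<oplus>\<^bsub>M\<^esub> u \<in> V"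
            using eqs by (auto simp: b_def)
          have uc: "u \<in> carrier M" using u Lc by blast
          have v: "a \<odot>\<^bsub>M\<^esub> (s \<oplus>\<^bsub>M\<^esub> u) \<in> V" using submoduleE(4)[OF VW(1) a u(2)] .
          have "w \<ominus>\<^bsub>M\<^esub> a \<odot>\<^bsub>M\<^esub> (s \<oplus>\<^bsub>M\<^esub> u) = t \<ominus>\<^bsub>M\<^esub> a \<odot>\<^bsub>M\<^esub> u"
            using a s uc tc
            by (simp add: wt a_minus_def smult_r_distr M.minus_add M.a_ac M.r_neg1 M.r_neg2)
          also have "\<dots> \<in> ?L"
            using submodule_diff[OF L t submoduleE(4)[OF L a u(1)]] .
          finally have "w \<ominus>\<^bsub>M\<^esub> a \<odot>\<^bsub>M\<^esub> (s \<oplus>\<^bsub>M\<^esub> u) \<in> V"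
            using submodule_diff[OF VW(2) w] v VW(3) eqs by blast
          then have "(w \<ominus>\<^bsub>M\<^esub> a \<odot>\<^bsub>M\<^esub> (s \<oplus>\<^bsub>M\<^esub> u)) \<oplus>\<^bsub>M\<^esub> a \<odot>\<^bsub>M\<^esub> (s \<oplus>\<^bsub>M\<^esub> u) \<in> V"
            using submoduleE(5)[OF VW(1)] v by blast
          moreover have "(w \<ominus>\<^bsub>M\<^esub> a \<odot>\<^bsub>M\<^esub> (s \<oplus>\<^bsub>M\<^esub> u)) \<oplus>\<^bsub>M\<^esub> a \<odot>\<^bsub>M\<^esub> (s \<oplus>\<^bsub>M\<^esub> u) = w"
            using a s uc w submoduleE(1)[OF VW(2)]
            by (auto simp: a_minus_def M.a_assoc M.l_neg)
          ultimately show ?thesis by simp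
        qed
      qed
    qed (rule VW(3))
    then show ?thesis using rr bb by (auto simp: r'_def)
  qed
  then show ?case by (intro exI[of _ r'] exI[of _ "N + 1"]) blast
qed

section \<open>Cosets of submodules\<close>

text \<open>No representative is singled out: every point of \<open>N\<close> serves as one. Since
  cosets are nonempty by definition, a family of cosets closed under intersection has the finite
  intersection property.\<close>

definition is_coset :: "('k, 'm) ring_scheme \<Rightarrow> ('k, 'a, 'n) module_scheme \<Rightarrow> 'a set \<Rightarrow> 'a set \<Rightarrow> bool" where
  "is_coset K M N W \<longleftrightarrow> submodule W K M \<and> N \<subseteq> carrier M \<and> N \<noteq> {} \<and>
     (\<forall>x\<in>N. \<forall>y\<in>carrier M. y \<in> N \<longleftrightarrow> y \<ominus>\<^bsub>M\<^esub> x \<in> W)"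

lemma (in module) is_coset_Int:
  assumes "is_coset R M N V" "is_coset R M N' W" "N \<inter> N' \<noteq> {}"
  shows "is_coset R M (N \<inter> N') (V \<inter> W)"
  unfolding is_coset_def
proof (intro conjI ballI)
  show "submodule (V \<inter> W) R M"
    using assms(1,2) by (auto simp: is_coset_def intro: submodule_Int)
  show "N \<inter> N' \<subseteq> carrier M"
    using assms(1) by (auto simp: is_coset_def)
  show "N \<inter> N' \<noteq> {}" by fact
  fix x y assume "x \<in> N \<inter> N'" "y \<in> carrier M"
  then have "y \<in> N \<longleftrightarrow> y \<ominus>\<^bsub>M\<^esub> x \<in> V" "y \<in> N' \<longleftrightarrow> y \<ominus>\<^bsub>M\<^esub> x \<in> W"
    using assms(1,2) unfolding is_coset_def by fast+
  then show "y \<in> N \<inter> N' \<longleftrightarrow> y \<ominus>\<^bsub>M\<^esub> x \<in> V \<inter> W" by simp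
qed

lemma (in module) is_coset_translate:
  assumes "submodule W R M" "s \<in> carrier M"
  shows "is_coset R M {x \<in> carrier M. x \<ominus>\<^bsub>M\<^esub> s \<in> W} W"
proof -
  have "(y \<ominus>\<^bsub>M\<^esub> s \<in> W) = (y \<ominus>\<^bsub>M\<^esub> x \<in> W)"
    if "x \<in> carrier M" "y \<in> carrier M" "x \<ominus>\<^bsub>M\<^esub> s \<in> W" for x y
  proof -
    have "y \<ominus>\<^bsub>M\<^esub> s = (y \<ominus>\<^bsub>M\<^esub> x) \<oplus>\<^bsub>M\<^esub> (x \<ominus>\<^bsub>M\<^esub> s)"
      using that assms by (simp add: a_minus_def M.a_assoc M.r_neg1)
    moreover have "y \<ominus>\<^bsub>M\<^esub> x = (y \<ominus>\<^bsub>M\<^esub> s) \<ominus>\<^bsub>M\<^esub> (x \<ominus>\<^bsub>M\<^esub> s)"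
      using that assms by (simp add: a_minus_def M.minus_add M.a_ac M.r_neg1 M.r_neg2)
    ultimately show ?thesis
      using submodule_diff[OF assms(1)] submoduleE(5)[OF assms(1)] that(3) by metis
  qed
  note eq = this
  have ne: "s \<ominus>\<^bsub>M\<^esub> s \<in> W"
    using assms submodule_zero by (simp add: a_minus_def M.r_neg)
  show ?thesis
    unfolding is_coset_def
  proof (intro conjI ballI)
    show "{x \<in> carrier M. x \<ominus>\<^bsub>M\<^esub> s \<in> W} \<noteq> {}" using ne assms(2) by blast
    fix x y assume "x \<in> {x \<in> carrier M. x \<ominus>\<^bsub>M\<^esub> s \<in> W}" "y \<in> carrier M"
    then show "y \<in> {x \<in> carrier M. x \<ominus>\<^bsub>M\<^esub> s \<in> W} \<longleftrightarrow> y \<ominus>\<^bsub>M\<^esub> x \<in> W"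
      using eq[of x y] by simp
  qed (use assms(1) in auto)
qed

section \<open>An inverse limit described by its projections\<close>

text \<open>The limit is characterised by its projections instead of by tuples:
  \<open>separated\<close> makes \<open>A\<close> embed in the product of the \<open>B j\<close>,
  \<open>compatible\<close> puts the image among the compatible families, and
  \<open>complete\<close> says that all such families occur.\<close>

locale profinite_projections =
  fixes K :: "'k ring" and A :: "('k, 'a) module"
    and J :: "'j set" and lej :: "'j \<Rightarrow> 'j \<Rightarrow> bool"
    and B :: "'j \<Rightarrow> ('k, 'b) module" and f :: "'j \<Rightarrow> 'j \<Rightarrow> 'b \<Rightarrow> 'b" and p :: "'j \<Rightarrow> 'a \<Rightarrow> 'b"
  assumes algebra: "k_algebra K A"
    and system: "fd_inverse_system K J lej B f"
    and hom: "j \<in> J \<Longrightarrow> alg_hom K A (B j) (p j)"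
    and separated: "\<lbrakk>x \<in> carrier A; \<And>j. j \<in> J \<Longrightarrow> p j x = \<zero>\<^bsub>B j\<^esub>\<rbrakk> \<Longrightarrow> x = \<zero>\<^bsub>A\<^esub>"
    and compatible: "\<lbrakk>i \<in> J; j \<in> J; lej i j; x \<in> carrier A\<rbrakk> \<Longrightarrow> f i j (p j x) = p i x"
    and complete: "\<lbrakk>\<And>j. j \<in> J \<Longrightarrow> b j \<in> carrier (B j);
      \<And>i j. \<lbrakk>i \<in> J; j \<in> J; lej i j\<rbrakk> \<Longrightarrow> f i j (b j) = b i\<rbrakk> \<Longrightarrow> \<exists>x\<in>carrier A. \<forall>j\<in>J. p j x = b j"
begin

sublocale module K A
  using algebra by (simp add: k_algebra_def)

sublocale A: ring A
  using algebra by (simp add: k_algebra_def)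

lemma field_K: "field K"
  using algebra by (simp add: k_algebra_def)

lemma J_nonempty: "J \<noteq> {}"
  using system unfolding fd_inverse_system_def by (elim conjE)

lemma directed:
  assumes "i \<in> J" "j \<in> J"
  obtains l where "l \<in> J" "lej i l" "lej j l"
proof -
  have "\<forall>i\<in>J. \<forall>j\<in>J. \<exists>l\<in>J. lej i l \<and> lej j l"
    using system unfolding fd_inverse_system_def by (elim conjE)
  then show thesis using assms that by blast
qed

lemma
  assumes "j \<in> J"
  shows B_module: "module K (B j)" and B_ring: "ring (B j)" and B_finite_dim: "finite_dim K (B j)"
proof -
  have "\<forall>j\<in>J. k_algebra K (B j) \<and> finite_dim K (B j)"
    using system unfolding fd_inverse_system_def by (elim conjE)
  with assms show "module K (B j)" "ring (B j)" "finite_dim K (B j)"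
    by (simp_all add: k_algebra_def)
qed

lemma p_ring_hom: "j \<in> J \<Longrightarrow> ring_hom_ring A (B j) (p j)"
  using hom[of j] B_ring[of j] A.ring_axioms by (simp add: alg_hom_def ring_hom_ring.intro ring_hom_ring_axioms.intro)

lemma
  assumes "j \<in> J"
  shows p_closed: "x \<in> carrier A \<Longrightarrow> p j x \<in> carrier (B j)"
    and p_zero: "p j \<zero>\<^bsub>A\<^esub> = \<zero>\<^bsub>B j\<^esub>"
    and p_add: "\<lbrakk>x \<in> carrier A; y \<in> carrier A\<rbrakk> \<Longrightarrow> p j (x \<oplus>\<^bsub>A\<^esub> y) = p j x \<oplus>\<^bsub>B j\<^esub> p j y"
    and p_mult: "\<lbrakk>x \<in> carrier A; y \<in> carrier A\<rbrakk> \<Longrightarrow> p j (x \<otimes>\<^bsub>A\<^esub> y) = p j x \<otimes>\<^bsub>B j\<^esub> p j y"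
    and p_neg: "x \<in> carrier A \<Longrightarrow> p j (\<ominus>\<^bsub>A\<^esub> x) = \<ominus>\<^bsub>B j\<^esub> p j x"
    and p_smult: "\<lbrakk>c \<in> carrier K; x \<in> carrier A\<rbrakk> \<Longrightarrow> p j (c \<odot>\<^bsub>A\<^esub> x) = c \<odot>\<^bsub>B j\<^esub> p j x"
proof -
  interpret h: ring_hom_ring A "B j" "p j" using p_ring_hom[OF assms] .
  show "x \<in> carrier A \<Longrightarrow> p j x \<in> carrier (B j)" "p j \<zero>\<^bsub>A\<^esub> = \<zero>\<^bsub>B j\<^esub>"
    "\<lbrakk>x \<in> carrier A; y \<in> carrier A\<rbrakk> \<Longrightarrow> p j (x \<oplus>\<^bsub>A\<^esub> y) = p j x \<oplus>\<^bsub>B j\<^esub> p j y"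
    "\<lbrakk>x \<in> carrier A; y \<in> carrier A\<rbrakk> \<Longrightarrow> p j (x \<otimes>\<^bsub>A\<^esub> y) = p j x \<otimes>\<^bsub>B j\<^esub> p j y"
    "x \<in> carrier A \<Longrightarrow> p j (\<ominus>\<^bsub>A\<^esub> x) = \<ominus>\<^bsub>B j\<^esub> p j x"
    by simp_all
  show "\<lbrakk>c \<in> carrier K; x \<in> carrier A\<rbrakk> \<Longrightarrow> p j (c \<odot>\<^bsub>A\<^esub> x) = c \<odot>\<^bsub>B j\<^esub> p j x"
    using hom[OF assms] by (simp add: alg_hom_def)
qed

lemma p_diff:
  "\<lbrakk>j \<in> J; x \<in> carrier A; y \<in> carrier A\<rbrakk> \<Longrightarrow> p j (x \<ominus>\<^bsub>A\<^esub> y) = p j x \<ominus>\<^bsub>B j\<^esub> p j y"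
  by (simp add: a_minus_def p_add p_neg)

lemma p_diff_eq_zero_iff:
  assumes "j \<in> J" "x \<in> carrier A" "y \<in> carrier A"
  shows "p j (x \<ominus>\<^bsub>A\<^esub> y) = \<zero>\<^bsub>B j\<^esub> \<longleftrightarrow> p j x = p j y"
proof -
  interpret Bj: ring "B j" using B_ring assms(1) .
  show ?thesis using assms by (simp add: p_diff p_closed)
qed

lemma p_image_submodule:
  assumes "j \<in> J" "submodule W K A"
  shows "submodule (p j ` W) K (B j)"
proof -
  interpret Bj: module K "B j" using B_module assms(1) .
  note E = submoduleE[OF assms(2)]
  have c: "x \<in> carrier A" if "x \<in> W" for x using E(1) that by blast
  show ?thesis
  proof (rule Bj.submoduleI)
    show "p j ` W \<subseteq> carrier (B j)" using c p_closed[OF assms(1)] by blast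
    show "\<zero>\<^bsub>B j\<^esub> \<in> p j ` W" using submodule_zero[OF assms(2)] p_zero[OF assms(1)] by (metis imageI)
    show "\<ominus>\<^bsub>B j\<^esub> a \<in> p j ` W" if "a \<in> p j ` W" for a
      using that E(3) c by (auto simp: p_neg[OF assms(1), symmetric])
    show "a \<oplus>\<^bsub>B j\<^esub> b \<in> p j ` W" if "a \<in> p j ` W" "b \<in> p j ` W" for a b
      using that E(5) c by (auto simp: p_add[OF assms(1), symmetric])
    show "a \<odot>\<^bsub>B j\<^esub> x \<in> p j ` W" if "a \<in> carrier K" "x \<in> p j ` W" for a x
      using that E(4) c by (auto simp: p_smult[OF assms(1), symmetric])
  qed
qed

text \<open>Pulls the rank function of \<open>B j\<close> back along \<open>p j\<close>. Equal ranks
  only give equal images, since whatever lies in the kernel of \<open>p j\<close> is not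
  seen.\<close>

lemma projection_rank:
  assumes "j \<in> J"
  obtains r :: "'a set \<Rightarrow> nat" and N where
    "\<And>V W. \<lbrakk>submodule V K A; submodule W K A; V \<subseteq> W\<rbrakk> \<Longrightarrow>
       r V \<le> r W \<and> r W \<le> N \<and> (r V = r W \<longrightarrow> p j ` V = p j ` W)"
proof -
  interpret Bj: module K "B j" using B_module assms(1) .
  obtain S where S: "finite S" "S \<subseteq> carrier (B j)" "carrier (B j) \<subseteq> lincomb K (B j) S"
    using B_finite_dim[OF assms] unfolding finite_dim_def lincomb_def by blast
  obtain r :: "'b set \<Rightarrow> nat" and N where r: "\<forall>V W. submodule V K (B j) \<longrightarrow> submodule W K (B j) \<longrightarrow>
    V \<subseteq> W \<longrightarrow> W \<subseteq> lincomb K (B j) S \<longrightarrow> r V \<le> r W \<and> r W \<le> N \<and> (r V = r W \<longrightarrow> V = W)"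
    using Bj.rank_exists[OF field_K S(1,2)] by (elim exE) (rule that)
  show thesis
  proof (rule that[of "\<lambda>W. r (p j ` W)" N])
    fix V W assume VW: "submodule V K A" "submodule W K A" "V \<subseteq> W"
    have "p j ` W \<subseteq> lincomb K (B j) S"
      using Bj.submoduleE(1)[OF p_image_submodule[OF assms VW(2)]] S(3) by blast
    then show "r (p j ` V) \<le> r (p j ` W) \<and> r (p j ` W) \<le> N \<and> (r (p j ` V) = r (p j ` W) \<longrightarrow> p j ` V = p j ` W)"
      using r[rule_format, OF p_image_submodule[OF assms VW(1)] p_image_submodule[OF assms VW(2)] image_mono[OF VW(3)]]
      by blast
  qed
qed

section \<open>Kernels of the projections and left ideals\<close>

definition U :: "'j \<Rightarrow> 'a set" where
  "U j = {x \<in> carrier A. p j x = \<zero>\<^bsub>B j\<^esub>}"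

lemma U_submodule: "j \<in> J \<Longrightarrow> submodule (U j) K A"
proof -
  assume j: "j \<in> J"
  interpret Bj: module K "B j" using B_module j .
  show ?thesis
    by (rule submoduleI) (auto simp: U_def p_zero[OF j] p_neg[OF j] p_add[OF j] p_smult[OF j] Bj.smult_r_null)
qed

lemma U_mult:
  assumes "j \<in> J" "u \<in> U j" "a \<in> carrier A"
  shows "a \<otimes>\<^bsub>A\<^esub> u \<in> U j" "u \<otimes>\<^bsub>A\<^esub> a \<in> U j"
proof -
  interpret Bj: ring "B j" using B_ring assms(1) .
  show "a \<otimes>\<^bsub>A\<^esub> u \<in> U j" "u \<otimes>\<^bsub>A\<^esub> a \<in> U j"
    using assms by (auto simp: U_def p_mult p_closed)
qed

lemma U_mono:
  assumes "i \<in> J" "j \<in> J" "lej i j"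
  shows "U j \<subseteq> U i"
proof
  fix x assume x: "x \<in> U j"
  have "f i j (\<zero>\<^bsub>B j\<^esub>) = \<zero>\<^bsub>B i\<^esub>"
    using compatible[OF assms, of "\<zero>\<^bsub>A\<^esub>"] assms by (simp add: p_zero)
  then show "x \<in> U i"
    using x compatible[OF assms, of x] by (auto simp: U_def)
qed

text \<open>Scaling by \<open>c\<close> is left multiplication by \<open>c\<close> times the unit,
  so absorbing left multiplication already includes absorbing scalars.\<close>

lemma left_ideal_submodule:
  assumes "left_ideal A I"
  shows "submodule I K A"
proof -
  interpret additive_subgroup I A using assms by (simp add: left_ideal_def)
  have "c \<odot>\<^bsub>A\<^esub> x \<in> I" if c: "c \<in> carrier K" and x: "x \<in> I" for c x
  proof -
    have xc: "x \<in> carrier A" using x a_subset by blast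
    have "(c \<odot>\<^bsub>A\<^esub> \<one>\<^bsub>A\<^esub>) \<otimes>\<^bsub>A\<^esub> x = c \<odot>\<^bsub>A\<^esub> (\<one>\<^bsub>A\<^esub> \<otimes>\<^bsub>A\<^esub> x)"
      using algebra c xc A.one_closed unfolding k_algebra_def by blast
    moreover have "(c \<odot>\<^bsub>A\<^esub> \<one>\<^bsub>A\<^esub>) \<otimes>\<^bsub>A\<^esub> x \<in> I"
      using assms c x by (simp add: left_ideal_def)
    ultimately show ?thesis using xc by simp
  qed
  then show ?thesis
    by (intro submoduleI) (use a_subset A.ring_axioms in auto)
qed

lemma left_ideal_iff:
  "left_ideal A I \<longleftrightarrow> submodule I K A \<and> (\<forall>a\<in>carrier A. \<forall>x\<in>I. a \<otimes>\<^bsub>A\<^esub> x \<in> I)"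
  using left_ideal_submodule submodule.axioms(1)[of I K A]
  by (auto simp: left_ideal_def intro: additive_subgroup.intro)

lemma left_ideal_Int_U:
  assumes "left_ideal A I" "j \<in> J"
  shows "left_ideal A (I \<inter> U j)"
  using assms submodule_Int[of I "U j"] U_submodule[of j] U_mult(1)[of j]
  by (auto simp: left_ideal_iff)

section \<open>Linear compactness\<close>

text \<open>In a maximal family of cosets closed under intersection, the images of all members in
  \<open>B\<^sub>j\<close> share a point, because one of least dimension lies in all others; by maximality the
  coset of \<open>U\<^sub>j\<close> above that point contains a member. The points so obtained are compatible.\<close>

lemma linear_compactness:
  fixes C W :: "nat \<Rightarrow> 'a set"
  assumes coset: "\<And>n. is_coset K A (C n) (W n)"
    and dec: "decseq C"
    and closed: "\<And>n x. \<lbrakk>x \<in> carrier A; \<And>j. j \<in> J \<Longrightarrow> \<exists>z\<in>C n. p j z = p j x\<rbrakk> \<Longrightarrow> x \<in> C n"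
  shows "\<exists>x\<in>carrier A. \<forall>n. x \<in> C n"
proof -
  \<comment> \<open>Zorn's lemma is applied to these families. Each contains the given chain, and
    any two of its members meet, since their intersection is again a coset.\<close>
  define \<F> where "\<F> = {\<N>. (\<forall>N\<in>\<N>. \<exists>W. is_coset K A N W) \<and> (\<forall>N\<in>\<N>. \<forall>N'\<in>\<N>. N \<inter> N' \<in> \<N>) \<and> range C \<subseteq> \<N>}"
  have "C m \<inter> C n = C (max m n)" for m n
    using decseqD[OF dec, of m n] decseqD[OF dec, of n m] by (cases "m \<le> n") (auto simp: max_def)
  then have "range C \<in> \<F>"
    using coset unfolding \<F>_def by blast
  moreover have "\<Union>\<C> \<in> \<F>" if ne: "\<C> \<noteq> {}" and chain: "subset.chain \<F> \<C>" for \<C>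
  proof -
    have sub: "\<C> \<subseteq> \<F>" and tot: "\<And>P Y. P \<in> \<C> \<Longrightarrow> Y \<in> \<C> \<Longrightarrow> P \<subseteq> Y \<or> Y \<subseteq> P"
      using chain by (auto simp: subset_chain_def)
    have "N \<inter> N' \<in> \<Union>\<C>" if N: "N \<in> \<Union>\<C>" "N' \<in> \<Union>\<C>" for N N'
    proof -
      obtain P Y where XY: "P \<in> \<C>" "Y \<in> \<C>" "N \<in> P" "N' \<in> Y" using N by blast
      then obtain Z where "Z \<in> \<C>" "N \<in> Z" "N' \<in> Z" using tot[of P Y] by blast
      then have "N \<inter> N' \<in> Z" using sub unfolding \<F>_def by blast
      then show ?thesis using \<open>Z \<in> \<C>\<close> by blast
    qed
    moreover have "\<exists>W. is_coset K A N W" if "N \<in> \<Union>\<C>" for N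
      using that sub unfolding \<F>_def by blast
    moreover have "range C \<subseteq> \<Union>\<C>"
      using ne sub unfolding \<F>_def by blast
    ultimately show ?thesis unfolding \<F>_def by blast
  qed
  ultimately have "\<exists>M\<in>\<F>. \<forall>P\<in>\<F>. M \<subseteq> P \<longrightarrow> P = M"
    by (intro subset_Zorn_nonempty) auto
  then obtain \<M> where M: "\<M> \<in> \<F>" and max: "\<And>P. P \<in> \<F> \<Longrightarrow> \<M> \<subseteq> P \<Longrightarrow> P = \<M>" by blast
  have Mcoset: "\<exists>W. is_coset K A N W" if "N \<in> \<M>" for N
    using M that unfolding \<F>_def by blast
  have MInt: "N \<inter> N' \<in> \<M>" if "N \<in> \<M>" "N' \<in> \<M>" for N N'
    using M that unfolding \<F>_def by blast
  have MC: "C n \<in> \<M>" for n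
    using M unfolding \<F>_def by blast
  have Mne: "N \<noteq> {}" "N \<subseteq> carrier A" if "N \<in> \<M>" for N
    using Mcoset[OF that] by (auto simp: is_coset_def)
  have "\<exists>x\<in>carrier A. \<exists>N\<in>\<M>. \<forall>z\<in>N. p j z = p j x" if j: "j \<in> J" for j
  proof -
    obtain r :: "'a set \<Rightarrow> nat" and d where
      r: "\<And>V W. \<lbrakk>submodule V K A; submodule W K A; V \<subseteq> W\<rbrakk> \<Longrightarrow>
         r V \<le> r W \<and> r W \<le> d \<and> (r V = r W \<longrightarrow> p j ` V = p j ` W)"
      using projection_rank[OF j] by metis
    let ?P = "\<lambda>(N, W). N \<in> \<M> \<and> is_coset K A N W"
    \<comment> \<open>Among all members, choose one whose direction \<open>W0\<close> has the least
      rank in \<open>B j\<close>; the pair \<open>(C 0, W 0)\<close> shows that there is something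
      to choose from.\<close>
    have "\<exists>q. ?P q \<and> (\<forall>q'. ?P q' \<longrightarrow> r (snd q) \<le> r (snd q'))"
      by (rule ex_has_least_nat[of ?P "(C 0, W 0)" "\<lambda>q. r (snd q)"]) (use MC coset in auto)
    then obtain N0 W0 where N0: "N0 \<in> \<M>" and W0: "is_coset K A N0 W0"
      and least: "\<And>N W. N \<in> \<M> \<Longrightarrow> is_coset K A N W \<Longrightarrow> r W0 \<le> r W"
      by auto
    obtain x where x: "x \<in> N0" using Mne(1)[OF N0] by blast
    have xc: "x \<in> carrier A" using x Mne(2)[OF N0] by blast
    \<comment> \<open>By minimality, \<open>W0 \<inter> W\<close> and \<open>W0\<close> have the
      same image in \<open>B j\<close>. A point \<open>z\<close> of \<open>N0 \<inter> N\<close> can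
      therefore be moved within \<open>N0 \<inter> N\<close> by some \<open>w\<close> in
      \<open>W0 \<inter> W\<close> with the image of \<open>x - z\<close>, which brings its image to
      that of \<open>x\<close>.\<close>
    have meets: "\<exists>z\<in>N. p j z = p j x" if N: "N \<in> \<M>" for N
    proof -
      obtain W where W: "is_coset K A N W" using Mcoset[OF N] by blast
      have N0N: "N0 \<inter> N \<in> \<M>" using MInt[OF N0 N] .
      have co: "is_coset K A (N0 \<inter> N) (W0 \<inter> W)"
        using is_coset_Int[OF W0 W Mne(1)[OF N0N]] .
      have sub: "submodule (W0 \<inter> W) K A" "submodule W0 K A"
        using co W0 by (simp_all add: is_coset_def)
      have eq: "p j ` (W0 \<inter> W) = p j ` W0"
        using r[OF sub Int_lower1] least[OF N0N co] by auto
      obtain z where z: "z \<in> N0 \<inter> N" using Mne(1)[OF N0N] by blast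
      have zc: "z \<in> carrier A" using z Mne(2)[OF N0] by blast
      have "x \<ominus>\<^bsub>A\<^esub> z \<in> W0" using W0 x z xc unfolding is_coset_def by fast
      then obtain w where w: "w \<in> W0 \<inter> W" "p j w = p j (x \<ominus>\<^bsub>A\<^esub> z)"
        using eq by (metis (no_types, lifting) imageE imageI)
      have wc: "w \<in> carrier A" using w(1) submoduleE(1)[OF sub(1)] by blast
      have "(w \<oplus>\<^bsub>A\<^esub> z) \<ominus>\<^bsub>A\<^esub> z = w"
        using wc zc by (simp add: a_minus_def M.a_assoc M.r_neg)
      then have wz: "w \<oplus>\<^bsub>A\<^esub> z \<in> N0 \<inter> N"
        using co z w(1) wc zc unfolding is_coset_def by (metis M.a_closed)
      interpret Bj: ring "B j" using B_ring[OF j] .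
      have "p j (w \<oplus>\<^bsub>A\<^esub> z) = p j x"
        using w(2) wc zc xc j
        by (simp add: p_add p_diff p_neg p_closed a_minus_def Bj.a_assoc Bj.l_neg)
      then show ?thesis using wz by blast
    qed
    define V where "V = {y \<in> carrier A. y \<ominus>\<^bsub>A\<^esub> x \<in> U j}"
    have V: "is_coset K A V (U j)"
      unfolding V_def by (rule is_coset_translate[OF U_submodule[OF j] xc])
    have V_iff: "z \<in> V \<longleftrightarrow> z \<in> carrier A \<and> p j z = p j x" for z
      using xc j p_diff_eq_zero_iff[OF j, of z x] by (auto simp: V_def U_def)
    \<comment> \<open>\<open>V\<close> is the fibre of \<open>p j\<close> through \<open>x\<close>
      and meets every member of \<open>\<M>\<close>. Adjoining all intersections with
      \<open>V\<close> thus stays inside \<open>\<F>\<close>, and maximality says that nothing new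
      was added.\<close>
    let ?M' = "\<M> \<union> (\<lambda>N. N \<inter> V) ` \<M>"
    have "?M' \<in> \<F>"
    proof -
      have "\<exists>W. is_coset K A N W" if N: "N \<in> ?M'" for N
      proof (cases "N \<in> \<M>")
        case False
        then obtain N' where N': "N' \<in> \<M>" "N = N' \<inter> V" using N by blast
        then obtain z where "z \<in> N'" "p j z = p j x" using meets by blast
        then have "N' \<inter> V \<noteq> {}" using Mne(2)[OF N'(1)] V_iff by blast
        moreover obtain W' where "is_coset K A N' W'" using Mcoset[OF N'(1)] by blast
        ultimately show ?thesis using is_coset_Int[OF _ V] N'(2) by blast
      qed (rule Mcoset)
      moreover have "N \<inter> N' \<in> ?M'" if NN': "N \<in> ?M'" "N' \<in> ?M'" for N N'
      proof -
        obtain P Y where XY: "P \<in> \<M>" "Y \<in> \<M>" "N = P \<or> N = P \<inter> V" "N' = Y \<or> N' = Y \<inter> V"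
          using NN' by blast
        have "N \<inter> N' = P \<inter> Y \<or> N \<inter> N' = (P \<inter> Y) \<inter> V" using XY(3,4) by blast
        moreover have "(P \<inter> Y) \<inter> V \<in> (\<lambda>N. N \<inter> V) ` \<M>"
          by (rule imageI[OF MInt[OF XY(1,2)]])
        ultimately show ?thesis using MInt[OF XY(1,2)] by (elim disjE) simp_all
      qed
      moreover have "range C \<subseteq> ?M'" using MC by blast
      ultimately show ?thesis unfolding \<F>_def by (intro CollectI conjI ballI)
    qed
    then have "?M' = \<M>" using max by blast
    then have "C 0 \<inter> V \<in> \<M>" using MC[of 0] by blast
    moreover have "\<forall>z\<in>C 0 \<inter> V. p j z = p j x" using V_iff by blast
    ultimately show ?thesis using xc by blast
  qed
  then obtain x N where xN: "\<And>j. j \<in> J \<Longrightarrow> x j \<in> carrier A \<and> N j \<in> \<M> \<and> (\<forall>z\<in>N j. p j z = p j (x j))"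
    by metis
  have "\<exists>a\<in>carrier A. \<forall>j\<in>J. p j a = p j (x j)"
  proof (rule complete)
    show "p j (x j) \<in> carrier (B j)" if "j \<in> J" for j
      using xN that p_closed by blast
    \<comment> \<open>The points \<open>x i\<close> and \<open>x j\<close> were chosen
      independently, but \<open>N i\<close> and \<open>N j\<close> have a common element
      \<open>z\<close>, whose images in \<open>B i\<close> and \<open>B j\<close> are the two chosen
      ones.\<close>
    show "f i j (p j (x j)) = p i (x i)" if ij: "i \<in> J" "j \<in> J" "lej i j" for i j
    proof -
      have NN: "N i \<inter> N j \<in> \<M>" using MInt xN ij by blast
      obtain z where "z \<in> N i" "z \<in> N j" using Mne(1)[OF NN] by blast
      moreover have "z \<in> carrier A" using calculation Mne(2)[OF NN] by blast
      ultimately show ?thesis using compatible[OF ij, of z] xN ij by metis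
    qed
  qed
  then obtain a where a: "a \<in> carrier A" "\<And>j. j \<in> J \<Longrightarrow> p j a = p j (x j)" by blast
  \<comment> \<open>\<open>C n\<close> meets each \<open>N j\<close>, so it contains for every
    \<open>j\<close> a point with the same image as \<open>a\<close>; closedness does the
    rest.\<close>
  have "a \<in> C n" for n
  proof (rule closed[OF a(1)])
    fix j assume j: "j \<in> J"
    have "C n \<inter> N j \<in> \<M>" using MInt MC xN j by blast
    then obtain z where "z \<in> C n" "z \<in> N j" using Mne(1) by blast
    then show "\<exists>z\<in>C n. p j z = p j a" using xN[OF j] a(2)[OF j] by metis
  qed
  then show ?thesis using a(1) by blast
qed

section \<open>Closedness of left ideals in a left D-ring\<close>

text \<open>Write \<open>L\<close> as the left annihilator of \<open>Y\<close>. If \<open>z\<close>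
  in \<open>L\<close> has the same image as \<open>x\<close> in \<open>B j\<close>, then
  \<open>x y\<close> and \<open>z y = 0\<close> have the same image there. So all projections of
  \<open>x y\<close> vanish, and \<open>x y = 0\<close>.\<close>

lemma left_ideal_closed:
  assumes "left_D_ring A" "left_ideal A L" "x \<in> carrier A"
    and "\<And>j. j \<in> J \<Longrightarrow> \<exists>z\<in>L. p j z = p j x"
  shows "x \<in> L"
proof -
  obtain Y where Y: "Y \<subseteq> carrier A" "L = left_ann A Y"
    using assms(1,2) unfolding left_D_ring_def by blast
  have "x \<otimes>\<^bsub>A\<^esub> y = \<zero>\<^bsub>A\<^esub>" if y: "y \<in> Y" for y
  proof (rule separated)
    have yc: "y \<in> carrier A" using y Y by blast
    then show "x \<otimes>\<^bsub>A\<^esub> y \<in> carrier A" using assms(3) by simp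
    fix j assume j: "j \<in> J"
    obtain z where z: "z \<in> L" "p j z = p j x" using assms(4)[OF j] by blast
    have "z \<in> carrier A" "z \<otimes>\<^bsub>A\<^esub> y = \<zero>\<^bsub>A\<^esub>" using z(1) y Y by (auto simp: left_ann_def)
    then show "p j (x \<otimes>\<^bsub>A\<^esub> y) = \<zero>\<^bsub>B j\<^esub>"
      using p_mult[OF j, of z y] p_mult[OF j, of x y] yc assms(3) z(2) p_zero[OF j] by simp
  qed
  then show ?thesis using Y assms(3) by (simp add: left_ann_def)
qed

lemma left_ideal_coset_closed:
  assumes "left_D_ring A" "left_ideal A L" "s \<in> carrier A" "x \<in> carrier A"
    and close: "\<And>j. j \<in> J \<Longrightarrow> \<exists>z\<in>{z \<in> carrier A. z \<ominus>\<^bsub>A\<^esub> s \<in> L}. p j z = p j x"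
  shows "x \<ominus>\<^bsub>A\<^esub> s \<in> L"
proof (rule left_ideal_closed[OF assms(1,2)])
  show "x \<ominus>\<^bsub>A\<^esub> s \<in> carrier A" using assms by simp
  fix j assume j: "j \<in> J"
  obtain z where z: "z \<in> carrier A" "z \<ominus>\<^bsub>A\<^esub> s \<in> L" "p j z = p j x" using close[OF j] by blast
  then have "p j (z \<ominus>\<^bsub>A\<^esub> s) = p j (x \<ominus>\<^bsub>A\<^esub> s)" using j assms(3,4) by (simp add: p_diff)
  then show "\<exists>z\<in>L. p j z = p j (x \<ominus>\<^bsub>A\<^esub> s)" using z(2) by blast
qed

section \<open>The ascending chain condition on left ideals\<close>

text \<open>The union of a chain has to be a left ideal for the D-ring property to apply to it and
  to its intersections with the kernels.\<close>

lemma left_ideal_UN: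
  fixes I :: "nat \<Rightarrow> 'a set"
  assumes "\<And>n. left_ideal A (I n)" "incseq I"
  shows "left_ideal A (\<Union>n. I n)"
proof -
  have sub: "submodule (I n) K A" for n using assms(1) by (simp add: left_ideal_iff)
  note E = submoduleE[OF sub]
  have "submodule (\<Union>n. I n) K A"
  proof (rule submoduleI)
    fix a b assume "a \<in> (\<Union>n. I n)" "b \<in> (\<Union>n. I n)"
    then obtain m n where "a \<in> I m" "b \<in> I n" by blast
    then have "a \<in> I (max m n)" "b \<in> I (max m n)"
      using incseqD[OF assms(2)] by (meson max.cobounded1 max.cobounded2 subsetD)+
    then show "a \<oplus>\<^bsub>A\<^esub> b \<in> (\<Union>n. I n)" using E(5) by blast
  qed (use E(1) submodule_zero[OF sub] in \<open>auto intro: E(3,4)\<close>)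
  then show ?thesis using assms(1) by (auto simp: left_ideal_iff)
qed

text \<open>If the chain is strict, no \<open>I\<^sub>n\<close> contains a neighbourhood of 0 in the union \<open>T\<close>, since
  \<open>U\<^sub>j\<close> has finite codimension. So cosets of open subgroups of \<open>T\<close> can be shrunk to avoid each
  \<open>I\<^sub>n\<close> in turn, and their common point contradicts \<open>T = \<Union>I\<^sub>n\<close>.\<close>

lemma ascending_left_ideals_stabilize:
  fixes I :: "nat \<Rightarrow> 'a set"
  assumes D: "left_D_ring A" and I: "\<And>n. left_ideal A (I n)" and inc: "incseq I"
  shows "\<exists>n. I (Suc n) = I n"
proof (rule ccontr)
  assume "\<nexists>n. I (Suc n) = I n"
  then have neq: "I (Suc n) \<noteq> I n" for n by blast
  define T where "T = (\<Union>n. I n)"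
  have T: "left_ideal A T" unfolding T_def by (rule left_ideal_UN[OF I inc])
  have Tsub: "submodule T K A" using T by (simp add: left_ideal_iff)
  have Isub: "submodule (I n) K A" for n using I by (simp add: left_ideal_iff)
  have Tc: "x \<in> carrier A" if "x \<in> T" for x using that submoduleE(1)[OF Tsub] by blast
  have IT: "I n \<subseteq> T" for n by (auto simp: T_def)
  have not_sub: "\<not> T \<inter> U j \<subseteq> I n" if j: "j \<in> J" for j n
  proof
    assume sub: "T \<inter> U j \<subseteq> I n"
    obtain r :: "'a set \<Rightarrow> nat" and d where
      r: "\<And>V W. \<lbrakk>submodule V K A; submodule W K A; V \<subseteq> W\<rbrakk> \<Longrightarrow>
         r V \<le> r W \<and> r W \<le> d \<and> (r V = r W \<longrightarrow> p j ` V = p j ` W)"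
      using projection_rank[OF j] by metis
    \<comment> \<open>From \<open>n\<close> on, \<open>I m\<close> contains the kernel of
      \<open>p j\<close> on \<open>T\<close>. Elements of \<open>T\<close> with equal images then
      differ by an element of \<open>I m\<close>, so a strict inclusion stays strict in
      \<open>B j\<close>. Ranks would grow beyond the bound \<open>d\<close>.\<close>
    have less: "r (I m) < r (I (Suc m))" if m: "n \<le> m" for m
    proof (rule ccontr)
      assume "\<not> r (I m) < r (I (Suc m))"
      then have eq: "p j ` I m = p j ` I (Suc m)"
        using r[OF Isub Isub, of m "Suc m"] incseq_SucD[OF inc, of m] by auto
      have "x \<in> I m" if x: "x \<in> I (Suc m)" for x
      proof -
        obtain y where y: "y \<in> I m" "p j y = p j x"
          using eq x by (metis (no_types, lifting) imageE imageI)
        have xy: "x \<in> T" "y \<in> T" using x y IT by auto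
        have "x \<ominus>\<^bsub>A\<^esub> y \<in> T \<inter> U j"
          using submodule_diff[OF Tsub xy] Tc xy y(2) p_diff_eq_zero_iff[OF j, of x y]
          by (simp add: U_def)
        then have "x \<ominus>\<^bsub>A\<^esub> y \<in> I m" using sub incseqD[OF inc m] by blast
        then have "(x \<ominus>\<^bsub>A\<^esub> y) \<oplus>\<^bsub>A\<^esub> y \<in> I m" using submoduleE(5)[OF Isub] y(1) by blast
        then show ?thesis using Tc[OF xy(1)] Tc[OF xy(2)]
          by (simp add: a_minus_def M.a_assoc M.l_neg)
      qed
      then show False using neq[of m] incseq_SucD[OF inc, of m] by blast
    qed
    have "k \<le> r (I (n + k))" for k
    proof (induction k)
      case (Suc k)
      then show ?case using less[of "n + k"] by simp
    qed simp
    then have "Suc d \<le> r (I (n + Suc d))" .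
    then show False using r[OF Isub Isub subset_refl, of "n + Suc d"] by simp
  qed
  \<comment> \<open>A pair \<open>(s, j)\<close> encodes the basic open coset of
    \<open>T \<inter> U j\<close> through \<open>s\<close>.\<close>
  define C where "C = (\<lambda>(s, j). {x \<in> carrier A. x \<ominus>\<^bsub>A\<^esub> s \<in> T \<inter> U j})"
  have step: "\<exists>\<tau>. \<tau> \<in> T \<times> J \<and> C \<tau> \<subseteq> C \<sigma> \<and> C \<tau> \<inter> I n = {}" if \<sigma>: "\<sigma> \<in> T \<times> J" for \<sigma> n
  proof -
    obtain s j where sj: "\<sigma> = (s, j)" "s \<in> T" "j \<in> J" using \<sigma> by blast
    have TU: "submodule (T \<inter> U j) K A" using submodule_Int[OF Tsub U_submodule[OF sj(3)]] .
    obtain t where t: "t \<in> T" "t \<in> U j" "t \<notin> I n" using not_sub[OF sj(3), of n] by blast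
    \<comment> \<open>Keep \<open>s\<close> if it is outside \<open>I n\<close>; otherwise shift it
      by \<open>t\<close>, which lies in \<open>T \<inter> U j\<close> but not in
      \<open>I n\<close>.\<close>
    have "\<exists>s'\<in>T. s' \<notin> I n \<and> s' \<ominus>\<^bsub>A\<^esub> s \<in> T \<inter> U j"
    proof (cases "s \<in> I n")
      case True
      have ts: "(t \<oplus>\<^bsub>A\<^esub> s) \<ominus>\<^bsub>A\<^esub> s = t"
        using Tc[OF t(1)] Tc[OF sj(2)] by (simp add: a_minus_def M.a_assoc M.r_neg)
      then have "t \<oplus>\<^bsub>A\<^esub> s \<notin> I n" using submodule_diff[OF Isub _ True] t(3) by metis
      then show ?thesis using ts t submoduleE(5)[OF Tsub t(1) sj(2)] by auto
    next
      case False
      have "s \<ominus>\<^bsub>A\<^esub> s \<in> T \<inter> U j"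
        using submodule_zero[OF TU] Tc[OF sj(2)] by (simp add: a_minus_def M.r_neg)
      then show ?thesis using False sj(2) by blast
    qed
    then obtain s' where s': "s' \<in> T" "s' \<notin> I n" "s' \<ominus>\<^bsub>A\<^esub> s \<in> T \<inter> U j" by blast
    \<comment> \<open>\<open>I n\<close> is closed and misses \<open>s'\<close>, so a single
      projection \<open>p i\<close> already separates \<open>s'\<close> from
      \<open>I n\<close>.\<close>
    obtain i where i: "i \<in> J" "\<And>z. z \<in> I n \<Longrightarrow> p i z \<noteq> p i s'"
      using left_ideal_closed[OF D I Tc[OF s'(1)]] s'(2) by blast
    \<comment> \<open>Being above \<open>j\<close> keeps the new coset inside the old one; being
      above \<open>i\<close> makes all its points agree with \<open>s'\<close> under
      \<open>p i\<close>, so it misses \<open>I n\<close>.\<close>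
    obtain l where l: "l \<in> J" "lej i l" "lej j l" using directed[OF i(1) sj(3)] .
    have "x \<ominus>\<^bsub>A\<^esub> s \<in> T \<inter> U j" if x: "x \<in> carrier A" "x \<ominus>\<^bsub>A\<^esub> s' \<in> T \<inter> U l" for x
    proof -
      have "x \<ominus>\<^bsub>A\<^esub> s' \<in> T \<inter> U j" using x(2) U_mono[OF sj(3) l(1,3)] by blast
      then have "(x \<ominus>\<^bsub>A\<^esub> s') \<oplus>\<^bsub>A\<^esub> (s' \<ominus>\<^bsub>A\<^esub> s) \<in> T \<inter> U j" using submoduleE(5)[OF TU] s'(3) by blast
      moreover have "(x \<ominus>\<^bsub>A\<^esub> s') \<oplus>\<^bsub>A\<^esub> (s' \<ominus>\<^bsub>A\<^esub> s) = x \<ominus>\<^bsub>A\<^esub> s"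
        using x(1) Tc[OF s'(1)] Tc[OF sj(2)] by (simp add: a_minus_def M.a_assoc M.r_neg1)
      ultimately show ?thesis by simp
    qed
    then have "C (s', l) \<subseteq> C \<sigma>" by (auto simp: C_def sj(1))
    moreover have "x \<notin> I n" if "x \<in> C (s', l)" for x
    proof -
      have "x \<in> carrier A" "x \<ominus>\<^bsub>A\<^esub> s' \<in> U i"
        using that U_mono[OF i(1) l(1,2)] by (auto simp: C_def)
      then have "p i x = p i s'"
        using p_diff_eq_zero_iff[OF i(1), of x s'] Tc[OF s'(1)] by (simp add: U_def)
      then show ?thesis using i(2) by blast
    qed
    ultimately show ?thesis using s'(1) l(1) by blast
  qed
  obtain j where j: "j \<in> J" using J_nonempty by blast
  \<comment> \<open>The first coset is arbitrary and avoids nothing in particular;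
    \<open>I n\<close> is avoided from stage \<open>Suc n\<close> on.\<close>
  have "\<exists>\<sigma>. \<forall>n. \<sigma> n \<in> T \<times> J \<and> (C (\<sigma> (Suc n)) \<subseteq> C (\<sigma> n) \<and> C (\<sigma> (Suc n)) \<inter> I n = {})"
  proof (rule dependent_nat_choice)
    show "\<exists>x. x \<in> T \<times> J" using j submodule_zero[OF Tsub] by blast
  qed (rule step)
  then obtain \<sigma> where \<sigma>: "\<And>n. \<sigma> n \<in> T \<times> J" "\<And>n. C (\<sigma> (Suc n)) \<subseteq> C (\<sigma> n)"
    "\<And>n. C (\<sigma> (Suc n)) \<inter> I n = {}" by blast
  define s where "s n = fst (\<sigma> n)" for n
  define k where "k n = snd (\<sigma> n)" for n
  have sk: "s n \<in> T" "k n \<in> J" "C (\<sigma> n) = {x \<in> carrier A. x \<ominus>\<^bsub>A\<^esub> s n \<in> T \<inter> U (k n)}" for n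
    using \<sigma>(1)[of n] by (auto simp: s_def k_def C_def split: prod.splits)
  \<comment> \<open>The D-ring property enters here for the union: \<open>T \<inter> U (k n)\<close>
    is a left ideal, hence closed, and so are its cosets.\<close>
  have TU: "left_ideal A (T \<inter> U (k n))" for n using left_ideal_Int_U[OF T sk(2)] .
  have "\<exists>x\<in>carrier A. \<forall>n. x \<in> C (\<sigma> n)"
  proof (rule linear_compactness[where C = "\<lambda>n. C (\<sigma> n)" and W = "\<lambda>n. T \<inter> U (k n)"])
    show "is_coset K A (C (\<sigma> n)) (T \<inter> U (k n))" for n
      unfolding sk(3) using TU[of n] by (intro is_coset_translate Tc sk(1)) (simp add: left_ideal_iff)
    show "decseq (\<lambda>n. C (\<sigma> n))" using \<sigma>(2) by (simp add: decseq_Suc_iff)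
    show "x \<in> C (\<sigma> n)" if "x \<in> carrier A" "\<And>j. j \<in> J \<Longrightarrow> \<exists>z\<in>C (\<sigma> n). p j z = p j x" for n x
      using left_ideal_coset_closed[OF D TU Tc[OF sk(1)] that(1)] that unfolding sk(3) by blast
  qed
  then obtain x where x: "x \<in> carrier A" "\<And>n. x \<in> C (\<sigma> n)" by blast
  have "x \<ominus>\<^bsub>A\<^esub> s 0 \<in> T" using x(2)[of 0] sk(3) by blast
  then have "(x \<ominus>\<^bsub>A\<^esub> s 0) \<oplus>\<^bsub>A\<^esub> s 0 \<in> T" using submoduleE(5)[OF Tsub] sk(1) by blast
  then have "x \<in> T" using x(1) Tc[OF sk(1)[of 0]] by (simp add: a_minus_def M.a_assoc M.l_neg)
  then obtain n where "x \<in> I n" by (auto simp: T_def)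
  then show False using x(2)[of "Suc n"] \<sigma>(3)[of n] by blast
qed

section \<open>Right annihilators of the kernels\<close>

definition R_ann :: "'j \<Rightarrow> 'a set" where
  "R_ann j = {x \<in> carrier A. \<forall>u\<in>U j. u \<otimes>\<^bsub>A\<^esub> x = \<zero>\<^bsub>A\<^esub>}"

lemma U_carrier: "u \<in> U j \<Longrightarrow> u \<in> carrier A"
  by (simp add: U_def)

text \<open>Since \<open>U j\<close> absorbs right multiplication,
  \<open>u (a x) = (u a) x = 0\<close> for \<open>u\<close> in \<open>U j\<close>. This is why a
  chain condition on left ideals applies to right annihilators.\<close>

lemma R_ann_left_ideal:
  assumes "j \<in> J"
  shows "left_ideal A (R_ann j)"
  unfolding left_ideal_iff
proof
  have smult: "u \<otimes>\<^bsub>A\<^esub> (c \<odot>\<^bsub>A\<^esub> x) = c \<odot>\<^bsub>A\<^esub> (u \<otimes>\<^bsub>A\<^esub> x)"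
    if "c \<in> carrier K" "u \<in> carrier A" "x \<in> carrier A" for c u x
    using algebra that unfolding k_algebra_def by blast
  show "submodule (R_ann j) K A"
    by (rule submoduleI) (auto simp: R_ann_def U_carrier A.r_minus A.r_distr smult smult_r_null)
  show "\<forall>a\<in>carrier A. \<forall>x\<in>R_ann j. a \<otimes>\<^bsub>A\<^esub> x \<in> R_ann j"
    using U_mult(2)[OF assms] by (auto simp: R_ann_def U_carrier A.m_assoc[symmetric])
qed

lemma R_ann_antimono: "U l \<subseteq> U j \<Longrightarrow> R_ann j \<subseteq> R_ann l"
  by (auto simp: R_ann_def)

text \<open>\<open>U l\<close> is the left annihilator of some \<open>Y\<close>. Then
  \<open>Y\<close> lies in \<open>R_ann l\<close>, hence in \<open>R_ann j\<close>, so every element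
  of \<open>U j\<close> annihilates \<open>Y\<close>.\<close>

lemma U_subset_if_R_ann_subset:
  assumes "left_D_ring A" "l \<in> J" "R_ann l \<subseteq> R_ann j"
  shows "U j \<subseteq> U l"
proof
  fix x assume x: "x \<in> U j"
  have "left_ideal A (U l)"
    using U_submodule[OF assms(2)] U_mult(1)[OF assms(2)] by (simp add: left_ideal_iff)
  then obtain Y where Y: "Y \<subseteq> carrier A" "U l = left_ann A Y"
    using assms(1) unfolding left_D_ring_def by blast
  have "Y \<subseteq> R_ann j"
    using Y assms(3) by (auto simp: R_ann_def left_ann_def)
  then show "x \<in> U l"
    using x unfolding Y(2) left_ann_def R_ann_def by (auto simp: U_carrier)
qed

lemma kernel_trivial:
  assumes D: "left_D_ring A"
  obtains j where "j \<in> J" "U j \<subseteq> {\<zero>\<^bsub>A\<^esub>}"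
proof -
  \<comment> \<open>A maximal right annihilator exists, for otherwise dependent choice would produce
    a strictly increasing sequence of left ideals.\<close>
  have "\<exists>j\<in>J. \<forall>l\<in>J. R_ann j \<subseteq> R_ann l \<longrightarrow> R_ann l = R_ann j"
  proof (rule ccontr)
    assume "\<not> ?thesis"
    then have step: "\<exists>l. l \<in> J \<and> R_ann j \<subseteq> R_ann l \<and> R_ann l \<noteq> R_ann j" if "j \<in> J" for j
      using that by blast
    have "\<exists>g. \<forall>n::nat. g n \<in> J \<and> (R_ann (g n) \<subseteq> R_ann (g (Suc n)) \<and> R_ann (g (Suc n)) \<noteq> R_ann (g n))"
      by (rule dependent_nat_choice) (use J_nonempty step in auto)
    then obtain g where g: "\<And>n::nat. g n \<in> J" "\<And>n. R_ann (g n) \<subseteq> R_ann (g (Suc n))"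
      "\<And>n. R_ann (g (Suc n)) \<noteq> R_ann (g n)" by blast
    have "\<exists>n. R_ann (g (Suc n)) = R_ann (g n)"
      by (rule ascending_left_ideals_stabilize[OF D])
        (use g R_ann_left_ideal in \<open>auto simp: incseq_Suc_iff\<close>)
    then show False using g(3) by blast
  qed
  then obtain j where j: "j \<in> J" "\<And>l. l \<in> J \<Longrightarrow> R_ann j \<subseteq> R_ann l \<Longrightarrow> R_ann l = R_ann j" by blast
  have "x = \<zero>\<^bsub>A\<^esub>" if x: "x \<in> U j" for x
  proof (rule separated)
    show "x \<in> carrier A" using x U_carrier by blast
    fix i assume i: "i \<in> J"
    obtain l where l: "l \<in> J" "lej i l" "lej j l" using directed[OF i j(1)] .
    \<comment> \<open>\<open>U l \<subseteq> U j\<close> enlarges the annihilator, and maximality of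
      \<open>R_ann j\<close> forbids a strict enlargement. Hence
      \<open>U j \<subseteq> U l \<subseteq> U i\<close> for arbitrary \<open>i\<close>.\<close>
    have "R_ann l = R_ann j" using j(2)[OF l(1)] R_ann_antimono U_mono[OF j(1) l(1,3)] by blast
    then have "x \<in> U l" using U_subset_if_R_ann_subset[OF D l(1), of j] x by blast
    then show "p i x = \<zero>\<^bsub>B i\<^esub>" using U_mono[OF i l(1,2)] by (auto simp: U_def)
  qed
  then show thesis using that j(1) by blast
qed

section \<open>Finite dimension from an injective projection\<close>

lemma finite_dim_of_left_D_ring:
  assumes D: "left_D_ring A"
  shows "finite_dim K A"
proof -
  obtain j where j: "j \<in> J" "U j \<subseteq> {\<zero>\<^bsub>A\<^esub>}" using kernel_trivial[OF D] .
  have inj: "inj_on (p j) (carrier A)"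
  proof (rule inj_onI)
    fix x y assume xy: "x \<in> carrier A" "y \<in> carrier A" "p j x = p j y"
    then have "x \<ominus>\<^bsub>A\<^esub> y \<in> U j" using p_diff_eq_zero_iff[OF j(1)] by (simp add: U_def)
    then have "x \<ominus>\<^bsub>A\<^esub> y = \<zero>\<^bsub>A\<^esub>" using j(2) by blast
    then show "x = y" using xy by simp
  qed
  obtain r :: "'a set \<Rightarrow> nat" and d where
    r: "\<And>V W. \<lbrakk>submodule V K A; submodule W K A; V \<subseteq> W\<rbrakk> \<Longrightarrow>
       r V \<le> r W \<and> r W \<le> d \<and> (r V = r W \<longrightarrow> p j ` V = p j ` W)"
    using projection_rank[OF j(1)] by metis
  let ?P = "\<lambda>S. finite S \<and> S \<subseteq> carrier A"
  \<comment> \<open>Instead of lifting a basis from \<open>B j\<close>, take a finite set whose span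
    has the largest rank. One more generator cannot change the image of the span in
    \<open>B j\<close>, hence by injectivity not the span. \<open>Suc d\<close> turns the bound
    \<open>d\<close> into a strict one.\<close>
  have "\<exists>S. ?P S \<and> (\<forall>S'. ?P S' \<longrightarrow> r (lincomb K A S') \<le> r (lincomb K A S))"
  proof (rule ex_has_greatest_nat[where b = "Suc d"])
    show "?P {}" by simp
    show "\<forall>S. ?P S \<longrightarrow> r (lincomb K A S) < Suc d"
      using r[OF lincomb_submodule lincomb_submodule subset_refl] by (simp add: less_Suc_eq_le)
  qed
  then obtain S where S: "finite S" "S \<subseteq> carrier A"
    and max: "\<And>S'. finite S' \<Longrightarrow> S' \<subseteq> carrier A \<Longrightarrow> r (lincomb K A S') \<le> r (lincomb K A S)" by blast
  have "x \<in> lincomb K A S" if x: "x \<in> carrier A" for x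
  proof -
    let ?S = "insert x S"
    have S': "finite ?S" "?S \<subseteq> carrier A" using S x by auto
    note sub = lincomb_submodule[OF S] lincomb_submodule[OF S']
    have le: "lincomb K A S \<subseteq> lincomb K A ?S" using lincomb_insert_mono[OF S(1) S'(2)] .
    have "p j ` lincomb K A S = p j ` lincomb K A ?S"
      using r[OF sub le] max[OF S'] by auto
    then have "lincomb K A S = lincomb K A ?S"
      using inj_on_image_eq_iff[OF inj] submoduleE(1)[OF sub(1)] submoduleE(1)[OF sub(2)] by blast
    then show ?thesis using lincomb_superset[OF S'] by blast
  qed
  then show ?thesis using S unfolding finite_dim_def lincomb_def by blast
qed

end

section \<open>The inverse limit as an instance\<close>

theorem theorem3p5:
  fixes K :: "'k ring" and A :: "('k, 'a) module"
    and J :: "'j set" and lej :: "'j \<Rightarrow> 'j \<Rightarrow> bool"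
    and B :: "'j \<Rightarrow> ('k, 'b) module" and f :: "'j \<Rightarrow> 'j \<Rightarrow> 'b \<Rightarrow> 'b"
  assumes "profinite_via K A J lej B f"
    and "left_D_ring A"
  shows "finite_dim K A"
proof -
  obtain h where h: "alg_iso K A (inv_limit J lej B f) h"
    and alg: "k_algebra K A" and sys: "fd_inverse_system K J lej B f"
    using assms(1) unfolding profinite_via_def by blast
  let ?L = "inv_limit J lej B f"
  have bij: "bij_betw h (carrier A) (carrier ?L)" and hom: "alg_hom K A ?L h"
    using h by (simp_all add: alg_iso_def)
  have A: "ring A" using alg by (simp add: k_algebra_def)
  interpret A: ring A by fact
  have "\<forall>j\<in>J. k_algebra K (B j) \<and> finite_dim K (B j)"
    using sys unfolding fd_inverse_system_def by (elim conjE)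
  then have Bring: "ring (B j)" if "j \<in> J" for j
    using that by (simp add: k_algebra_def)
  have h_carrier: "h x \<in> carrier ?L" if "x \<in> carrier A" for x
    using bij that by (auto simp: bij_betw_def)
  have hom_j: "alg_hom K A (B j) (\<lambda>x. h x j)" if "j \<in> J" for j
    using hom that h_carrier by (auto simp: alg_hom_def ring_hom_def inv_limit_def)
  \<comment> \<open>Coordinatewise, \<open>h\<close> is a homomorphism between the rings
    \<open>A\<close> and \<open>B j\<close>, so the ring axioms need not be verified for
    \<open>inv_limit\<close>.\<close>
  have h_zero: "h \<zero>\<^bsub>A\<^esub> j = \<zero>\<^bsub>B j\<^esub>" if "j \<in> J" for j
  proof -
    interpret ring_hom_ring A "B j" "\<lambda>x. h x j"
      using hom_j[OF that] Bring[OF that] A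
      by (simp add: alg_hom_def ring_hom_ring.intro ring_hom_ring_axioms.intro)
    show ?thesis by simp
  qed
  \<comment> \<open>The projections are the coordinates of \<open>h\<close>. Injectivity of
    \<open>h\<close> yields \<open>separated\<close>, the carrier of \<open>inv_limit\<close> yields
    \<open>compatible\<close>, and surjectivity yields \<open>complete\<close>.\<close>
  interpret profinite_projections K A J lej B f "\<lambda>j x. h x j"
  proof (unfold_locales, goal_cases)
    case (4 x)
    have "h x = h \<zero>\<^bsub>A\<^esub>"
    proof (rule PiE_ext)
      show "h x \<in> (\<Pi>\<^sub>E j\<in>J. carrier (B j))" "h \<zero>\<^bsub>A\<^esub> \<in> (\<Pi>\<^sub>E j\<in>J. carrier (B j))"
        using h_carrier[OF 4(1)] h_carrier[OF A.zero_closed] by (simp_all add: inv_limit_def)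
      show "h x j = h \<zero>\<^bsub>A\<^esub> j" if "j \<in> J" for j
        using 4(2) h_zero that by simp
    qed
    then show ?case using bij 4(1) by (auto simp: bij_betw_def dest: inj_onD)
  next
    case (5 i j x)
    then show ?case using h_carrier[of x] by (auto simp: inv_limit_def)
  next
    case (6 b)
    \<comment> \<open>Elements of the limit are extensional functions, so \<open>b\<close> is first
      restricted to \<open>J\<close>.\<close>
    have "(\<lambda>j\<in>J. b j) \<in> carrier ?L"
      using 6 by (auto simp: inv_limit_def)
    then have "(\<lambda>j\<in>J. b j) \<in> h ` carrier A"
      using bij by (simp add: bij_betw_def)
    then obtain x where "x \<in> carrier A" "h x = (\<lambda>j\<in>J. b j)"
      by (metis imageE)
    then show ?case by (intro bexI[of _ x]) auto
  qed (use alg sys hom_j in auto)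
  show ?thesis by (rule finite_dim_of_left_D_ring[OF assms(2)])
qed

end
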